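(* Let $k$ be a field of characteristic $p>0$ such that $[k\colon k^p]<\infty$, and let $\mathfrak{a}$ be an ideal in the polynomial ring $k[x_1,\ldots,x_n]$. If $\mathfrak{a}$ can be generated by polynomials of degree at most $d$, then for every non-negative real number $c$, the ideal $\tau(\mathfrak{a}^c)$ can be generated by polynomials of degree at most $\lfloor cd\rfloor$.
   Context: Here $\lfloor t\rfloor$ is the largest integer $\leq t$, and degree means total degree. Let $R=k[x_1,\ldots,x_n]$; it is a regular ring of characteristic $p$ whose Frobenius morphism is finite. For an ideal $J$ of $R$ and $q=p^e$, $J^{[q]}$ is the ideal generated by $\{u^q \mid u\in J\}$. For an ideal $\mathfrak{b}$ of $R$ and $q=p^e$ with $e\geq 1$, $\mathfrak{b}^{[1/q]}$ denotes the unique smallest ideal $J$ of $R$ (with respect to inclusion) such that $\mathfrak{b}\subseteq J^{[q]}$ (it exists for such $R$). Generalized test ideals: for an ideal $\mathfrak{a}$ of $R$ and a real number $c>0$, $\tau(\mathfrak{a}^c)=\bigcup_{e>0}\left(\mathfrak{a}^{\lceil cp^e\rceil}\right)^{[1/p^e]}$; this is an increasing union of ideals, so $\tau(\mathfrak{a}^c)=(\mathfrak{a}^{\lceil cp^e\rceil})^{[1/p^e]}$ for all $e\gg 0$. For $c=0$: $\tau(\mathfrak{a}^0)=R$ if $\mathfrak{a}\neq(0)$ and $\tau(\mathfrak{a}^0)=(0)$ if $\mathfrak{a}=(0)$. *)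

theory Defs
  imports
    Complex_Main
    "HOL-Library.Poly_Mapping"
    "HOL-Computational_Algebra.Computational_Algebra"
begin

text \<open>
  The polynomial ring $k[x_1,\ldots,x_n]$: the variables are indexed by a finite type \<open>'n\<close>
  with \<open>CARD('n) = n\<close>, and a polynomial is a finitely supported map from exponent vectors
  to coefficients, multiplied by convolution.
\<close>

type_synonym ('n, 'k) mpoly = "('n \<Rightarrow>\<^sub>0 nat) \<Rightarrow>\<^sub>0 'k"

text \<open>The zero polynomial gets total degree 0; it thus satisfies every bound \<open>\<le> d\<close>.\<close>

definition total_degree :: "('n::finite, 'k::zero) mpoly \<Rightarrow> nat" where
  "total_degree f = Max (insert 0 ((\<lambda>m. \<Sum>i\<in>UNIV. Poly_Mapping.lookup m i) ` Poly_Mapping.keys f))"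

text \<open>
  For a subfield \<open>K\<close> of the field \<open>'k\<close>: $[k : K] < \infty$, i.e. $k$ is spanned by finitely many
  elements as a vector space over \<open>K\<close>.
\<close>

definition finite_degree_over :: "'k::field set \<Rightarrow> bool" where
  "finite_degree_over K \<longleftrightarrow>
     (\<exists>B. finite B \<and> (\<forall>x. \<exists>c. (\<forall>b\<in>B. c b \<in> K) \<and> x = (\<Sum>b\<in>B. c b * b)))"

text \<open>Ideals of a commutative ring are its submodules as a module over itself.\<close>

definition is_ideal :: "'a::comm_ring_1 set \<Rightarrow> bool" where
  "is_ideal = module.subspace (*)"

definition ideal_gen :: "'a::comm_ring_1 set \<Rightarrow> 'a set" where
  "ideal_gen = module.span (*)"

definition ideal_mult :: "'a::comm_ring_1 set \<Rightarrow> 'a set \<Rightarrow> 'a set" where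
  "ideal_mult I J = ideal_gen {x * y |x y. x \<in> I \<and> y \<in> J}"

primrec ideal_pow :: "'a::comm_ring_1 set \<Rightarrow> nat \<Rightarrow> 'a set" where
  "ideal_pow I 0 = UNIV"
| "ideal_pow I (Suc m) = ideal_mult I (ideal_pow I m)"

text \<open>\<open>frob_power J q\<close> is $J^{[q]}$ and \<open>frob_root b q\<close> is $b^{[1/q]}$.\<close>

definition frob_power :: "'a::comm_ring_1 set \<Rightarrow> nat \<Rightarrow> 'a set" where
  "frob_power J q = ideal_gen {u ^ q |u. u \<in> J}"

definition frob_root :: "'a::comm_ring_1 set \<Rightarrow> nat \<Rightarrow> 'a set" where
  "frob_root b q = (LEAST J. is_ideal J \<and> b \<subseteq> frob_power J q)"

text \<open>
  \<open>test_ideal p a c\<close> is $\tau(a^c)$ in characteristic \<open>p\<close>; only \<open>c \<ge> 0\<close> is meaningful.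
\<close>

definition test_ideal :: "nat \<Rightarrow> 'a::comm_ring_1 set \<Rightarrow> real \<Rightarrow> 'a set" where
  "test_ideal p a c =
     (if c = 0 then (if a = {0} then {0} else UNIV)
      else (\<Union>e\<in>{0<..}. frob_root (ideal_pow a (nat \<lceil>c * real (p ^ e)\<rceil>)) (p ^ e)))"

end

theory Submission
  imports Defs
begin

text \<open>
  Let \<open>q = p\<^sup>e\<close>. A coordinate function \<open>\<phi>\<close> of a basis of $k$ over $k^q$, followed by
  the $q$-th root, satisfies \<open>\<phi> (c\<^sup>q x) = c \<phi> x\<close>. Together with a residue \<open>\<alpha>\<close> of
  exponent vectors modulo \<open>q\<close> it gives an additive operator \<open>T\<close> on polynomials with
  \<open>T (u\<^sup>q f) = u T f\<close> that divides degrees by \<open>q\<close>. The ideal $b^{[1/q]}$ is generated by the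
  values of these operators on generators of $b$, so $(a^{\lceil cq\rceil})^{[1/q]}$ is
  generated in degrees at most $d\lceil cq\rceil/q$, which is below $\lfloor cd\rfloor+1$ for
  large \<open>e\<close>. As these ideals increase with \<open>e\<close>, the small \<open>e\<close> do not matter for
  their union.
\<close>

section \<open>Ideals\<close>

lemma module_mult: "module ((*) :: 'a::comm_ring_1 \<Rightarrow> 'a \<Rightarrow> 'a)"
  by unfold_locales (auto simp: algebra_simps)

lemma is_ideal_ideal_gen: "is_ideal (ideal_gen S)"
  by (simp add: is_ideal_def ideal_gen_def module.subspace_span[OF module_mult])

lemma ideal_gen_minimal: "S \<subseteq> I \<Longrightarrow> is_ideal I \<Longrightarrow> ideal_gen S \<subseteq> I"
  unfolding is_ideal_def ideal_gen_def by (rule module.span_minimal[OF module_mult])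

lemma ideal_gen_base: "x \<in> S \<Longrightarrow> x \<in> ideal_gen S"
  unfolding ideal_gen_def by (rule module.span_base[OF module_mult])

lemma ideal_gen_mono: "S \<subseteq> T \<Longrightarrow> ideal_gen S \<subseteq> ideal_gen T"
  unfolding ideal_gen_def by (rule module.span_mono[OF module_mult])

lemma is_ideal_mult_left: "is_ideal I \<Longrightarrow> x \<in> I \<Longrightarrow> r * x \<in> I"
  unfolding is_ideal_def by (rule module.subspace_scale[OF module_mult])

lemma is_ideal_mult_right: "is_ideal I \<Longrightarrow> x \<in> I \<Longrightarrow> x * r \<in> I"
  by (metis is_ideal_mult_left mult.commute)

lemma is_ideal_add: "is_ideal I \<Longrightarrow> x \<in> I \<Longrightarrow> y \<in> I \<Longrightarrow> x + y \<in> I"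
  unfolding is_ideal_def by (rule module.subspace_add[OF module_mult])

lemma is_ideal_0: "is_ideal I \<Longrightarrow> 0 \<in> I"
  unfolding is_ideal_def by (rule module.subspace_0[OF module_mult])

lemma is_ideal_sum: "is_ideal I \<Longrightarrow> (\<And>x. x \<in> A \<Longrightarrow> f x \<in> I) \<Longrightarrow> sum f A \<in> I"
  unfolding is_ideal_def by (rule module.subspace_sum[OF module_mult])

text \<open>Combinations are built one multiple of a generator at a time, so \<open>P\<close> is
  never asked to be closed under sums of two arbitrary elements.\<close>

lemma ideal_gen_induct [consumes 1, case_names zero add]:
  assumes "x \<in> ideal_gen S" and "P 0"
    and "\<And>r s y. s \<in> S \<Longrightarrow> P y \<Longrightarrow> P (r * s + y)"
  shows "P x"
  using assms unfolding ideal_gen_def by (rule module.span_induct_alt[OF module_mult])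

lemma ideal_gen_1: "ideal_gen {1} = (UNIV :: 'a::comm_ring_1 set)"
  unfolding ideal_gen_def by (simp add: module.span_singleton[OF module_mult])

lemma is_ideal_directed_UN:
  assumes "\<And>i. i \<in> A \<Longrightarrow> is_ideal (I i)" and "A \<noteq> {}"
    and "\<And>i j. i \<in> A \<Longrightarrow> j \<in> A \<Longrightarrow> \<exists>k\<in>A. I i \<subseteq> I k \<and> I j \<subseteq> I k"
  shows "is_ideal (\<Union>i\<in>A. I i)"
  unfolding is_ideal_def
proof (rule module.subspaceI[OF module_mult])
  show "0 \<in> (\<Union>i\<in>A. I i)"
    using assms(1,2) is_ideal_0 by blast
next
  fix x y assume "x \<in> (\<Union>i\<in>A. I i)" "y \<in> (\<Union>i\<in>A. I i)"
  then obtain k where "k \<in> A" "x \<in> I k" "y \<in> I k"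
    using assms(3) by blast
  then show "x + y \<in> (\<Union>i\<in>A. I i)"
    using assms(1) is_ideal_add by blast
next
  fix c x assume "x \<in> (\<Union>i\<in>A. I i)"
  then show "c * x \<in> (\<Union>i\<in>A. I i)"
    using assms(1) is_ideal_mult_left by blast
qed

section \<open>Products and powers of ideals\<close>

lemma is_ideal_ideal_mult: "is_ideal (ideal_mult I J)"
  by (simp add: ideal_mult_def is_ideal_ideal_gen)

lemma is_ideal_ideal_pow: "is_ideal (ideal_pow I m)"
proof (cases m)
  case 0
  then show ?thesis by (simp add: is_ideal_def module.subspace_UNIV[OF module_mult])
qed (simp add: is_ideal_ideal_mult)

lemma ideal_pow_Suc_subset: "ideal_pow I (Suc m) \<subseteq> ideal_pow I m"
  unfolding ideal_pow.simps ideal_mult_def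
  by (rule ideal_gen_minimal) (auto intro: is_ideal_mult_left is_ideal_ideal_pow)

lemma ideal_pow_antimono: "m \<le> n \<Longrightarrow> ideal_pow I n \<subseteq> ideal_pow I m"
  by (rule lift_Suc_antimono_le[of "ideal_pow I"]) (rule ideal_pow_Suc_subset)

lemma ideal_pow_mult:
  "x \<in> ideal_pow I m \<Longrightarrow> y \<in> ideal_pow I n \<Longrightarrow> x * y \<in> ideal_pow I (m + n)"
proof (induction m arbitrary: x)
  case 0
  then show ?case by (simp add: is_ideal_mult_left is_ideal_ideal_pow)
next
  case (Suc m)
  from Suc.prems(1) have "x \<in> ideal_gen {x * y |x y. x \<in> I \<and> y \<in> ideal_pow I m}"
    by (simp add: ideal_mult_def)
  then show ?case
  proof (induction rule: ideal_gen_induct)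
    case zero
    then show ?case by (simp add: is_ideal_0 is_ideal_ideal_mult)
  next
    case (add r s z)
    then obtain u v where uv: "s = u * v" "u \<in> I" "v \<in> ideal_pow I m"
      by blast
    then have "u * (v * y) \<in> {x * y |x y. x \<in> I \<and> y \<in> ideal_pow I (m + n)}"
      using Suc.IH[OF uv(3) Suc.prems(2)] by blast
    then have "u * (v * y) \<in> ideal_pow I (Suc m + n)"
      by (simp add: ideal_mult_def ideal_gen_base)
    from is_ideal_mult_left[OF is_ideal_ideal_pow this]
    have "r * (u * (v * y)) + z * y \<in> ideal_pow I (Suc m + n)"
      by (intro is_ideal_add is_ideal_ideal_pow add.IH)
    then show ?case
      by (simp add: uv algebra_simps)
  qed
qed

lemma ideal_pow_power: "x \<in> ideal_pow I m \<Longrightarrow> x ^ n \<in> ideal_pow I (m * n)"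
proof (induction n)
  case (Suc n)
  then show ?case using ideal_pow_mult[of x I m "x ^ n" "m * n"] by simp
qed simp

text \<open>Multiplication is linear in each factor: first \<open>y\<close> is expanded in
  \<open>T\<close> with \<open>s\<close> fixed, then \<open>x\<close> in \<open>S\<close>. This
  turns generators of the factors into generators of the product, so degrees can be tracked.\<close>

lemma ideal_mult_ideal_gen:
  "ideal_mult (ideal_gen S) (ideal_gen T) = ideal_gen {s * t |s t. s \<in> S \<and> t \<in> T}"
proof
  let ?P = "ideal_gen {s * t |s t. s \<in> S \<and> t \<in> T}"
  have st: "s * y \<in> ?P" if "s \<in> S" "y \<in> ideal_gen T" for s y
    using that(2)
  proof (induction rule: ideal_gen_induct)
    case zero
    then show ?case by (simp add: is_ideal_0 is_ideal_ideal_gen)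
  next
    case (add r t z)
    then have "s * t \<in> ?P"
      using that(1) by (intro ideal_gen_base) blast
    from is_ideal_mult_left[OF is_ideal_ideal_gen this]
    have "r * (s * t) + s * z \<in> ?P"
      by (intro is_ideal_add is_ideal_ideal_gen add.IH)
    then show ?case by (simp add: algebra_simps)
  qed
  have "x * y \<in> ?P" if "x \<in> ideal_gen S" "y \<in> ideal_gen T" for x y
    using that(1)
  proof (induction rule: ideal_gen_induct)
    case zero
    then show ?case by (simp add: is_ideal_0 is_ideal_ideal_gen)
  next
    case (add r s z)
    then have "s * y \<in> ?P"
      using that(2) by (intro st)
    from is_ideal_mult_left[OF is_ideal_ideal_gen this]
    have "r * (s * y) + z * y \<in> ?P"
      by (intro is_ideal_add is_ideal_ideal_gen add.IH)
    then show ?case by (simp add: algebra_simps)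
  qed
  then show "ideal_mult (ideal_gen S) (ideal_gen T) \<subseteq> ?P"
    unfolding ideal_mult_def by (intro ideal_gen_minimal is_ideal_ideal_gen) auto
  show "?P \<subseteq> ideal_mult (ideal_gen S) (ideal_gen T)"
    unfolding ideal_mult_def by (rule ideal_gen_mono) (auto intro: ideal_gen_base)
qed

section \<open>Frobenius powers of ideals\<close>

lemma is_ideal_frob_power: "is_ideal (frob_power J q)"
  by (simp add: frob_power_def is_ideal_ideal_gen)

lemma frob_power_base: "u \<in> J \<Longrightarrow> u ^ q \<in> frob_power J q"
  unfolding frob_power_def by (rule ideal_gen_base) blast

lemma frob_power_mult_subset: "frob_power J (q * r) \<subseteq> frob_power (frob_power J q) r"
proof -
  have "u ^ (q * r) \<in> frob_power (frob_power J q) r" if "u \<in> J" for u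
    unfolding power_mult using that by (intro frob_power_base)
  then show ?thesis
    by (subst frob_power_def) (intro ideal_gen_minimal is_ideal_frob_power; auto)
qed

section \<open>Total degree\<close>

lemma total_degree_le_iff:
  "total_degree f \<le> n \<longleftrightarrow>
     (\<forall>m\<in>Poly_Mapping.keys f. (\<Sum>i\<in>UNIV. Poly_Mapping.lookup m i) \<le> n)"
  by (auto simp: total_degree_def)

lemma total_degree_mult_le:
  "total_degree (f * g) \<le> total_degree f + total_degree (g :: ('n::finite, 'k::comm_ring_1) mpoly)"
  unfolding total_degree_le_iff
proof
  fix m assume "m \<in> Poly_Mapping.keys (f * g)"
  then obtain a b where ab: "m = a + b" "a \<in> Poly_Mapping.keys f" "b \<in> Poly_Mapping.keys g"
    using keys_mult by blast
  have "(\<Sum>i\<in>UNIV. Poly_Mapping.lookup a i) \<le> total_degree f"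
    "(\<Sum>i\<in>UNIV. Poly_Mapping.lookup b i) \<le> total_degree g"
    using ab total_degree_le_iff by blast+
  then show "(\<Sum>i\<in>UNIV. Poly_Mapping.lookup m i) \<le> total_degree f + total_degree g"
    by (simp add: ab lookup_add sum.distrib)
qed

lemma total_degree_1 [simp]: "total_degree (1 :: ('n::finite, 'k::comm_ring_1) mpoly) = 0"
  by (simp add: total_degree_def)

text \<open>The products of \<open>m\<close> elements of \<open>G\<close> serve as \<open>H\<close>;
  degrees add up under multiplication. For \<open>m = 0\<close> the empty product 1 generates the
  whole ring.\<close>

lemma ideal_pow_ideal_gen_degree_le:
  fixes G :: "('n::finite, 'k::comm_ring_1) mpoly set"
  assumes "\<forall>g\<in>G. total_degree g \<le> d"
  shows "\<exists>H. (\<forall>h\<in>H. total_degree h \<le> d * m) \<and> ideal_pow (ideal_gen G) m = ideal_gen H"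
proof (induction m)
  case 0
  then show ?case by (intro exI[of _ "{1}"]) (simp add: ideal_gen_1)
next
  case (Suc m)
  then obtain H where H: "\<forall>h\<in>H. total_degree h \<le> d * m"
    "ideal_pow (ideal_gen G) m = ideal_gen H"
    by blast
  have "total_degree (g * h) \<le> d * Suc m" if "g \<in> G" "h \<in> H" for g h
    using total_degree_mult_le[of g h] H(1) assms that by fastforce
  then show ?case
    using H(2) by (intro exI[of _ "{g * h |g h. g \<in> G \<and> h \<in> H}"])
      (auto simp: ideal_mult_ideal_gen)
qed

section \<open>Cartier operators\<close>

text \<open>These are the linear functionals of \<open>k\<close>, viewed as a vector space over itself with
  scalar multiplication \<open>c\<^sup>q * x\<close>; this avoids taking $q$-th roots.\<close>

definition inv_frob_linear :: "nat \<Rightarrow> ('k::field \<Rightarrow> 'k) \<Rightarrow> bool" where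
  "inv_frob_linear q \<phi> \<longleftrightarrow>
     (\<forall>x y. \<phi> (x + y) = \<phi> x + \<phi> y) \<and> (\<forall>c x. \<phi> (c ^ q * x) = c * \<phi> x)"

lemma inv_frob_linear_add: "inv_frob_linear q \<phi> \<Longrightarrow> \<phi> (x + y) = \<phi> x + \<phi> y"
  and inv_frob_linear_scale: "inv_frob_linear q \<phi> \<Longrightarrow> \<phi> (c ^ q * x) = c * \<phi> x"
  by (simp_all add: inv_frob_linear_def)

lemma inv_frob_linear_0: "inv_frob_linear q \<phi> \<Longrightarrow> \<phi> 0 = 0"
  using inv_frob_linear_add[of q \<phi> 0 0] by (metis add.right_neutral add_left_cancel)

text \<open>Since Frobenius is additive, \<open>k\<close> is a vector space over itself under
  \<open>a ^ q * x\<close>. The maps \<open>\<phi> b\<close> are the coordinates in a basis, and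
  vanish for \<open>b\<close> outside it. Each \<open>x\<close> has only finitely many nonzero
  coordinates, so the expansion is a finite sum.\<close>

lemma inv_frob_linear_coordinates:
  assumes "prime CHAR('k::field)" and "q = CHAR('k::field) ^ e"
  obtains \<phi> :: "'k::field \<Rightarrow> 'k \<Rightarrow> 'k" where "\<And>b. inv_frob_linear q (\<phi> b)"
    and "\<And>x. finite {b. \<phi> b x \<noteq> 0}" and "\<And>x. (\<Sum>b | \<phi> b x \<noteq> 0. \<phi> b x ^ q * b) = x"
proof -
  define scale where "scale a x = a ^ q * x" for a x :: 'k
  interpret vs: vector_space scale
    by unfold_locales
      (simp_all only: scale_def freshmans_dream'[OF assms] distrib_left distrib_right
        power_mult_distrib mult.assoc power_one mult_1)
  define B where "B = vs.extend_basis {}"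
  have B: "vs.independent B" "vs.span B = UNIV"
    using vs.independent_extend_basis[OF vs.independent_empty]
      vs.span_extend_basis[OF vs.independent_empty] by (simp_all only: B_def not_False_eq_True)
  have "inv_frob_linear q (\<lambda>x. vs.representation B x b)" for b
    unfolding inv_frob_linear_def scale_def[symmetric]
    by (simp add: B vs.representation_add vs.representation_scale)
  moreover have "(\<Sum>b | vs.representation B x b \<noteq> 0. vs.representation B x b ^ q * b) = x" for x
    using vs.sum_nonzero_representation_eq[OF B(1), of x] by (simp add: B scale_def)
  ultimately show ?thesis
    using that[of "\<lambda>b x. vs.representation B x b"] vs.finite_representation by blast
qed

section \<open>Division with remainder by q on exponent vectors\<close>

abbreviation exp_scale :: "nat \<Rightarrow> ('n \<Rightarrow>\<^sub>0 nat) \<Rightarrow> ('n \<Rightarrow>\<^sub>0 nat)" where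
  "exp_scale q \<equiv> Poly_Mapping.map ((*) q)"

abbreviation exp_div :: "nat \<Rightarrow> ('n \<Rightarrow>\<^sub>0 nat) \<Rightarrow> ('n \<Rightarrow>\<^sub>0 nat)" where
  "exp_div q \<equiv> Poly_Mapping.map (\<lambda>x. x div q)"

abbreviation exp_mod :: "nat \<Rightarrow> ('n \<Rightarrow>\<^sub>0 nat) \<Rightarrow> ('n \<Rightarrow>\<^sub>0 nat)" where
  "exp_mod q \<equiv> Poly_Mapping.map (\<lambda>x. x mod q)"

text \<open>\<open>Poly_Mapping.map\<close> applies its function only to nonzero entries; this makes
  no difference here, as all three functions fix 0.\<close>

lemma lookup_exp_scale: "Poly_Mapping.lookup (exp_scale q m) i = q * Poly_Mapping.lookup m i"
  and lookup_exp_div: "Poly_Mapping.lookup (exp_div q m) i = Poly_Mapping.lookup m i div q"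
  and lookup_exp_mod: "Poly_Mapping.lookup (exp_mod q m) i = Poly_Mapping.lookup m i mod q"
  by (simp_all add: Poly_Mapping.map.rep_eq when_def)

lemmas lookup_exp = lookup_exp_scale lookup_exp_div lookup_exp_mod lookup_add

lemma exp_mod_add_scale_div: "exp_mod q m + exp_scale q (exp_div q m) = m"
  by (rule poly_mapping_eqI) (simp add: lookup_exp)

lemma exp_mod_scale_add: "exp_mod q (exp_scale q g + m) = exp_mod q m"
  by (rule poly_mapping_eqI) (simp add: lookup_exp)

lemma exp_div_scale_add: "q > 0 \<Longrightarrow> exp_div q (exp_scale q g + m) = g + exp_div q m"
  by (rule poly_mapping_eqI) (simp add: lookup_exp)

section \<open>Monomials and the characteristic of the polynomial ring\<close>

lemma single_power:
  "Poly_Mapping.single m c ^ n = Poly_Mapping.single (exp_scale n m) (c ^ n :: 'k::comm_ring_1)"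
proof (induction n)
  case 0
  have "exp_scale 0 m = 0"
    by (rule poly_mapping_eqI) (simp add: lookup_exp)
  then show ?case by (simp only: power_0 single_one)
next
  case (Suc n)
  have "m + exp_scale n m = exp_scale (Suc n) m"
    by (rule poly_mapping_eqI) (simp add: lookup_exp)
  with Suc show ?case by (simp only: power_Suc mult_single)
qed

lemma single_sum: "Poly_Mapping.single m (sum f A) = (\<Sum>a\<in>A. Poly_Mapping.single m (f a))"
  by (induction A rule: infinite_finite_induct) (simp_all add: single_add)

lemma poly_mapping_eq_sum_single:
  "f = (\<Sum>m\<in>Poly_Mapping.keys f. Poly_Mapping.single m (Poly_Mapping.lookup f m))"
  by (rule poly_mapping_eqI)
    (auto simp: lookup_sum lookup_single when_def in_keys_iff sum.delta)

lemma CHAR_mpoly: "CHAR(('n, 'k::comm_ring_1) mpoly) = CHAR('k)"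
proof (rule CHAR_eqI)
  show "of_nat CHAR('k) = (0 :: ('n, 'k) mpoly)"
    by (simp flip: single_of_nat)
next
  fix n assume "of_nat n = (0 :: ('n, 'k) mpoly)"
  then have "Poly_Mapping.lookup (Poly_Mapping.single (0 :: 'n \<Rightarrow>\<^sub>0 nat) (of_nat n :: 'k)) 0 = 0"
    by simp
  then show "CHAR('k) dvd n"
    by (simp add: of_nat_eq_0_iff_char_dvd del: single_of_nat)
qed

text \<open>If \<phi> is the coordinate of a basis element b, this is the coordinate at
  \<open>b * x^\<alpha>\<close> of the polynomial ring over its subring of q-th powers, followed by
  the q-th root. For q > 0, an \<alpha> with an entry at least q gives the zero operator.\<close>

definition cartier ::
  "nat \<Rightarrow> ('k::field \<Rightarrow> 'k) \<Rightarrow> ('n \<Rightarrow>\<^sub>0 nat) \<Rightarrow> ('n, 'k) mpoly \<Rightarrow> ('n, 'k) mpoly" where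
  "cartier q \<phi> \<alpha> f = (\<Sum>m\<in>Poly_Mapping.keys f.
     if exp_mod q m = \<alpha> then Poly_Mapping.single (exp_div q m) (\<phi> (Poly_Mapping.lookup f m)) else 0)"

lemma cartier_0 [simp]: "cartier q \<phi> \<alpha> 0 = 0"
  by (simp add: cartier_def)

context
  fixes q :: nat and \<phi> :: "'k::field \<Rightarrow> 'k"
  assumes \<phi>: "inv_frob_linear q \<phi>"
begin

lemma cartier_add: "cartier q \<phi> \<alpha> (f + g) = cartier q \<phi> \<alpha> f + cartier q \<phi> \<alpha> g"
  unfolding cartier_def
  by (rule setsum_keys_plus_distrib)
    (simp_all add: inv_frob_linear_0[OF \<phi>] inv_frob_linear_add[OF \<phi>] single_add)

lemma cartier_sum: "cartier q \<phi> \<alpha> (sum f A) = (\<Sum>a\<in>A. cartier q \<phi> \<alpha> (f a))"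
  by (induction A rule: infinite_finite_induct) (simp_all add: cartier_add)

lemma cartier_single:
  "cartier q \<phi> \<alpha> (Poly_Mapping.single m c) =
     (if exp_mod q m = \<alpha> then Poly_Mapping.single (exp_div q m) (\<phi> c) else 0)"
  by (simp add: cartier_def inv_frob_linear_0[OF \<phi>])

text \<open>Both sides are additive in \<open>u\<close> and \<open>f\<close>, for \<open>u\<close>
  because q is a power of the characteristic. This leaves monomials, where adding q times
  \<open>m\<close> to the exponent \<open>l\<close> keeps its residue and adds \<open>m\<close> to
  its quotient.\<close>

lemma cartier_power_mult:
  assumes "prime CHAR('k)" and "q = CHAR('k) ^ e"
  shows "cartier q \<phi> \<alpha> (u ^ q * f) = u * cartier q \<phi> \<alpha> (f :: ('n, 'k) mpoly)"
proof -
  have "q > 0"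
    using assms by (simp add: prime_gt_0_nat)
  have mono: "cartier q \<phi> \<alpha> (Poly_Mapping.single m c ^ q * Poly_Mapping.single l a) =
      Poly_Mapping.single m c * cartier q \<phi> \<alpha> (Poly_Mapping.single l a)"
    for m l :: "'n \<Rightarrow>\<^sub>0 nat" and c a
    using \<open>q > 0\<close> by (simp add: single_power mult_single cartier_single exp_mod_scale_add
        exp_div_scale_add inv_frob_linear_scale[OF \<phi>])
  let ?s = "\<lambda>(f :: ('n, 'k) mpoly) m. Poly_Mapping.single m (Poly_Mapping.lookup f m)"
  have u: "u = (\<Sum>m\<in>Poly_Mapping.keys u. ?s u m)" and f: "f = (\<Sum>m\<in>Poly_Mapping.keys f. ?s f m)"
    by (rule poly_mapping_eq_sum_single)+
  have "u ^ q = (\<Sum>m\<in>Poly_Mapping.keys u. ?s u m ^ q)"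
    by (subst u, rule freshmans_dream_sum'[where n = e]) (simp_all add: CHAR_mpoly assms)
  then have "u ^ q * f = (\<Sum>m\<in>Poly_Mapping.keys u. \<Sum>l\<in>Poly_Mapping.keys f. ?s u m ^ q * ?s f l)"
    by (simp only: f[symmetric] flip: sum_product)
  then have "cartier q \<phi> \<alpha> (u ^ q * f) =
      (\<Sum>m\<in>Poly_Mapping.keys u. \<Sum>l\<in>Poly_Mapping.keys f. ?s u m * cartier q \<phi> \<alpha> (?s f l))"
    by (simp only: cartier_sum mono)
  also have "\<dots> = (\<Sum>m\<in>Poly_Mapping.keys u. ?s u m) * (\<Sum>l\<in>Poly_Mapping.keys f. cartier q \<phi> \<alpha> (?s f l))"
    by (simp only: sum_product)
  also have "\<dots> = u * cartier q \<phi> \<alpha> f"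
    by (simp only: u[symmetric] f[symmetric] flip: cartier_sum)
  finally show ?thesis .
qed

end

text \<open>Each monomial of the result is the entrywise quotient of a monomial of \<open>f\<close>,
  and \<open>q * (x div q) \<le> x\<close> in each entry.\<close>

lemma total_degree_cartier: "q * total_degree (cartier q \<phi> \<alpha> f) \<le> total_degree f"
proof (cases "q = 0")
  case False
  have "total_degree (cartier q \<phi> \<alpha> f) \<le> total_degree f div q"
    unfolding total_degree_le_iff
  proof
    fix m assume "m \<in> Poly_Mapping.keys (cartier q \<phi> \<alpha> f)"
    then obtain l where l: "l \<in> Poly_Mapping.keys f" "m = exp_div q l"
      unfolding cartier_def using keys_sum by (fastforce split: if_splits)
    have "q * (\<Sum>i\<in>UNIV. Poly_Mapping.lookup m i) \<le> (\<Sum>i\<in>UNIV. Poly_Mapping.lookup l i)"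
      by (auto simp: l lookup_exp sum_distrib_left intro: sum_mono)
    also have "\<dots> \<le> total_degree f"
      using l total_degree_le_iff by blast
    finally show "(\<Sum>i\<in>UNIV. Poly_Mapping.lookup m i) \<le> total_degree f div q"
      using False by (simp add: less_eq_div_iff_mult_less_eq mult.commute)
  qed
  then show ?thesis
    using False by (simp add: less_eq_div_iff_mult_less_eq mult.commute)
qed simp

section \<open>Frobenius roots\<close>

context
  fixes q e :: nat
  assumes prime_char: "prime CHAR('k::field)" and q_eq: "q = CHAR('k::field) ^ e"
begin

text \<open>Writing \<open>f\<close> as a sum of terms \<open>r * u^q\<close> with \<open>u\<close>
  in \<open>J\<close>, the operator sends each term to \<open>u\<close> times its value at
  \<open>r\<close>, which lies in \<open>J\<close>.\<close>

lemma cartier_mem_of_mem_frob_power: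
  fixes f :: "('n, 'k) mpoly"
  assumes "inv_frob_linear q \<phi>" and "is_ideal J" and "f \<in> frob_power J q"
  shows "cartier q \<phi> \<alpha> f \<in> J"
proof -
  from assms(3) have "f \<in> ideal_gen {u ^ q |u. u \<in> J}"
    by (simp add: frob_power_def)
  then show ?thesis
  proof (induction rule: ideal_gen_induct)
    case zero
    then show ?case by (simp add: is_ideal_0 assms)
  next
    case (add r s y)
    then obtain u where u: "s = u ^ q" "u \<in> J" by blast
    have "cartier q \<phi> \<alpha> (r * s + y) = u * cartier q \<phi> \<alpha> r + cartier q \<phi> \<alpha> y"
      using assms(1) by (simp add: u(1) cartier_add mult.commute[of r]
          cartier_power_mult[OF _ prime_char q_eq])
    then show ?case
      using u add assms by (simp add: is_ideal_add is_ideal_mult_right)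
  qed
qed

text \<open>The polynomial is recovered from its coordinates: \<open>f\<close> is the sum over
  \<alpha> and b of \<open>b * x^\<alpha>\<close> times the q-th power of
  \<open>cartier q (\<phi> b) \<alpha> f\<close>.\<close>

lemma mem_frob_power_of_cartier_mem:
  fixes f :: "('n, 'k) mpoly"
  assumes J: "\<And>\<phi> \<alpha>. inv_frob_linear q \<phi> \<Longrightarrow> cartier q \<phi> \<alpha> f \<in> J"
  shows "f \<in> frob_power J q"
proof -
  obtain \<phi> :: "'k \<Rightarrow> 'k \<Rightarrow> 'k" where \<phi>: "\<And>b. inv_frob_linear q (\<phi> b)"
    "\<And>x. finite {b. \<phi> b x \<noteq> 0}" "\<And>x. (\<Sum>b | \<phi> b x \<noteq> 0. \<phi> b x ^ q * b) = x"
    using inv_frob_linear_coordinates[OF prime_char q_eq] by blast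
  have "q > 0"
    using prime_char by (simp add: q_eq prime_gt_0_nat)
  let ?c = "Poly_Mapping.lookup f"
  define K where "K = Poly_Mapping.keys f"
  \<comment> \<open>Only the residues and basis elements that occur in \<open>f\<close> are kept,
    which makes the double sum finite.\<close>
  define A where "A = exp_mod q ` K"
  define D where "D = (\<Union>m\<in>K. {b. \<phi> b (?c m) \<noteq> 0})"
  have fin: "finite K" "finite A" "finite D"
    by (auto simp: K_def A_def D_def \<phi>(2))
  have D_sum: "(\<Sum>b\<in>D. \<phi> b (?c m) ^ q * b) = ?c m" if "m \<in> K" for m
  proof -
    \<comment> \<open>The additional elements of \<open>D\<close> contribute
      \<open>0 ^ q * b\<close>, which is 0 because q > 0.\<close>
    have "(\<Sum>b\<in>D. \<phi> b (?c m) ^ q * b) = (\<Sum>b | \<phi> b (?c m) \<noteq> 0. \<phi> b (?c m) ^ q * b)"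
      using that fin \<open>q > 0\<close> by (intro sum.mono_neutral_right) (auto simp: D_def)
    then show ?thesis by (simp add: \<phi>(3))
  qed
  have summand: "Poly_Mapping.single \<alpha> b * cartier q (\<phi> b) \<alpha> f ^ q =
      (\<Sum>m\<in>K. if exp_mod q m = \<alpha> then Poly_Mapping.single m (\<phi> b (?c m) ^ q * b) else 0)" for \<alpha> b
  proof -
    have "cartier q (\<phi> b) \<alpha> f ^ q = (\<Sum>m\<in>K. (if exp_mod q m = \<alpha>
        then Poly_Mapping.single (exp_div q m) (\<phi> b (?c m)) else 0) ^ q)"
      unfolding cartier_def K_def
      by (rule freshmans_dream_sum'[where n = e]) (simp_all add: CHAR_mpoly prime_char q_eq)
    then show ?thesis
      using \<open>q > 0\<close> by (auto simp: sum_distrib_left power_0_left single_power mult_single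
          exp_mod_add_scale_div mult.commute[of b] intro!: sum.cong)
  qed
  have "(\<Sum>\<alpha>\<in>A. \<Sum>b\<in>D. Poly_Mapping.single \<alpha> b * cartier q (\<phi> b) \<alpha> f ^ q) =
      (\<Sum>\<alpha>\<in>A. \<Sum>m\<in>K. \<Sum>b\<in>D.
        if exp_mod q m = \<alpha> then Poly_Mapping.single m (\<phi> b (?c m) ^ q * b) else 0)"
    unfolding summand by (intro sum.cong refl sum.swap)
  also have "\<dots> = (\<Sum>m\<in>K. \<Sum>\<alpha>\<in>A. \<Sum>b\<in>D.
        if exp_mod q m = \<alpha> then Poly_Mapping.single m (\<phi> b (?c m) ^ q * b) else 0)"
    by (rule sum.swap)
  \<comment> \<open>The sum over b reassembles the coefficient of \<open>m\<close>; afterwards only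
    the residue of \<open>m\<close> itself contributes to the sum over \<alpha>.\<close>
  also have "\<dots> = (\<Sum>m\<in>K. \<Sum>\<alpha>\<in>A. if exp_mod q m = \<alpha> then Poly_Mapping.single m (?c m) else 0)"
    by (intro sum.cong refl) (auto simp: D_sum simp flip: single_sum)
  also have "\<dots> = (\<Sum>m\<in>K. Poly_Mapping.single m (?c m))"
    using fin by (intro sum.cong refl) (auto simp: A_def)
  also have "\<dots> = f"
    unfolding K_def by (rule poly_mapping_eq_sum_single[symmetric])
  finally have "f = (\<Sum>\<alpha>\<in>A. \<Sum>b\<in>D. Poly_Mapping.single \<alpha> b * cartier q (\<phi> b) \<alpha> f ^ q)" ..
  also have "\<dots> \<in> frob_power J q"
    by (intro is_ideal_sum is_ideal_mult_left is_ideal_frob_power frob_power_base J \<phi>)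
  finally show ?thesis .
qed

text \<open>The two preceding lemmas say that \<open>J\<close> is admissible and lies in every
  admissible ideal. Allowing any generating set \<open>G\<close> is what lets degree bounds pass to
  the root.\<close>

lemma frob_root_eq_cartier_ideal:
  fixes G :: "('n, 'k) mpoly set"
  defines "J \<equiv> ideal_gen {cartier q \<phi> \<alpha> g |\<phi> \<alpha> g. inv_frob_linear q \<phi> \<and> g \<in> G}"
  shows "frob_root (ideal_gen G) q = J"
  unfolding frob_root_def
proof (rule Least_equality)
  have "g \<in> frob_power J q" if "g \<in> G" for g
    using that unfolding J_def by (intro mem_frob_power_of_cartier_mem ideal_gen_base) blast
  then have "ideal_gen G \<subseteq> frob_power J q"
    by (intro ideal_gen_minimal is_ideal_frob_power) blast
  then show "is_ideal J \<and> ideal_gen G \<subseteq> frob_power J q"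
    by (simp add: J_def is_ideal_ideal_gen)
next
  fix I assume I: "is_ideal I \<and> ideal_gen G \<subseteq> frob_power I q"
  then show "J \<le> I"
    unfolding J_def
    by (intro ideal_gen_minimal) (auto intro!: cartier_mem_of_mem_frob_power ideal_gen_base)
qed

text \<open>Taking \<open>\<bb>\<close> as its own generating set shows that the
  \<open>LEAST\<close> in the definition of the root is attained.\<close>

lemma frob_root_is_least:
  fixes \<bb> :: "('n, 'k) mpoly set"
  assumes "is_ideal \<bb>"
  shows "is_ideal (frob_root \<bb> q)" and "\<bb> \<subseteq> frob_power (frob_root \<bb> q) q"
    and "is_ideal J \<Longrightarrow> \<bb> \<subseteq> frob_power J q \<Longrightarrow> frob_root \<bb> q \<subseteq> J"
proof -
  have "ideal_gen \<bb> = \<bb>"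
    using assms by (simp add: ideal_gen_def is_ideal_def module.span_eq_iff[OF module_mult])
  note root = frob_root_eq_cartier_ideal[of \<bb>, unfolded this]
  show "is_ideal (frob_root \<bb> q)"
    by (simp add: root is_ideal_ideal_gen)
  show "\<bb> \<subseteq> frob_power (frob_root \<bb> q) q"
    unfolding root by (intro subsetI mem_frob_power_of_cartier_mem ideal_gen_base) blast
  show "frob_root \<bb> q \<subseteq> J" if "is_ideal J" "\<bb> \<subseteq> frob_power J q"
    unfolding root using that
    by (intro ideal_gen_minimal) (auto intro!: cartier_mem_of_mem_frob_power)
qed

text \<open>An operator that sends 1 to a nonzero constant maps \<open>f ^ q\<close> to a unit
  multiple of \<open>f\<close>, and maps the Frobenius power of \<open>I\<close> into
  \<open>I\<close>.\<close>

lemma mem_of_power_mem_frob_power: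
  fixes f :: "('n, 'k) mpoly"
  assumes "is_ideal I" and "f ^ q \<in> frob_power I q"
  shows "f \<in> I"
proof -
  obtain \<phi> :: "'k \<Rightarrow> 'k \<Rightarrow> 'k" where \<phi>: "\<And>b. inv_frob_linear q (\<phi> b)"
    "\<And>x. finite {b. \<phi> b x \<noteq> 0}" "\<And>x. (\<Sum>b | \<phi> b x \<noteq> 0. \<phi> b x ^ q * b) = x"
    using inv_frob_linear_coordinates[OF prime_char q_eq] by blast
  \<comment> \<open>If all coordinates of 1 vanished, 1 would be an empty sum.\<close>
  obtain b where b: "\<phi> b 1 \<noteq> 0"
    using \<phi>(3)[of 1] by fastforce
  have "cartier q (\<phi> b) 0 (f ^ q * 1) \<in> I"
    using cartier_mem_of_mem_frob_power[OF \<phi>(1) assms, of b 0] by simp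
  moreover have "cartier q (\<phi> b) 0 (1 :: ('n, 'k) mpoly) = Poly_Mapping.single 0 (\<phi> b 1)"
  proof -
    have "exp_mod q 0 = (0 :: 'n \<Rightarrow>\<^sub>0 nat)" "exp_div q 0 = (0 :: 'n \<Rightarrow>\<^sub>0 nat)"
      by (rule poly_mapping_eqI, simp add: lookup_exp)+
    then show ?thesis
      using cartier_single[OF \<phi>(1), of b 0 "0 :: 'n \<Rightarrow>\<^sub>0 nat" 1] by simp
  qed
  ultimately have "f * Poly_Mapping.single 0 (\<phi> b 1) \<in> I"
    by (simp only: cartier_power_mult[OF \<phi>(1) prime_char q_eq])
  from is_ideal_mult_right[OF assms(1) this, of "Poly_Mapping.single 0 (inverse (\<phi> b 1))"]
  show ?thesis
    using b by (simp add: mult.assoc mult_single)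
qed

end

section \<open>Test ideals\<close>

text \<open>Let J be the right-hand side. As \<open>?m' \<le> ?m * p\<close>, the p-th power of an
  \<open>f\<close> in the \<open>?m\<close>-th power of \<open>\<aa>\<close> lies in the Frobenius
  power of J for \<open>p ^ e * p\<close>. Taking p-th roots puts \<open>f\<close> in the one for
  \<open>p ^ e\<close>, and minimality of the left-hand root applies.\<close>

lemma frob_root_ideal_pow_mono:
  fixes \<aa> :: "('n, 'k::field) mpoly set"
  assumes "prime CHAR('k)" and "CHAR('k) = p" and "c \<ge> 0"
  shows "frob_root (ideal_pow \<aa> (nat \<lceil>c * real (p ^ e)\<rceil>)) (p ^ e) \<subseteq>
    frob_root (ideal_pow \<aa> (nat \<lceil>c * real (p ^ Suc e)\<rceil>)) (p ^ Suc e)"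
proof -
  let ?m = "nat \<lceil>c * real (p ^ e)\<rceil>" and ?m' = "nat \<lceil>c * real (p ^ Suc e)\<rceil>"
  let ?J = "frob_root (ideal_pow \<aa> ?m') (p ^ Suc e)"
  have least: "is_ideal (frob_root (ideal_pow \<aa> m) (p ^ i)) \<and>
      ideal_pow \<aa> m \<subseteq> frob_power (frob_root (ideal_pow \<aa> m) (p ^ i)) (p ^ i)" for m i
    using frob_root_is_least[OF assms(1), of _ i "ideal_pow \<aa> m"] assms(2)
      by (auto simp: is_ideal_ideal_pow)
  have "c * real (p ^ Suc e) = c * real (p ^ e) * real p"
    by simp
  also have "\<dots> \<le> real ?m * real p"
    by (intro mult_right_mono) linarith+
  finally have "c * real (p ^ Suc e) \<le> real_of_int (int (?m * p))"
    by (simp only: of_int_of_nat_eq of_nat_mult of_int_mult)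
  then have "?m' \<le> ?m * p"
    unfolding nat_le_iff ceiling_le_iff .
  have "f \<in> frob_power ?J (p ^ e)" if "f \<in> ideal_pow \<aa> ?m" for f
  proof -
    have "f ^ p \<in> ideal_pow \<aa> ?m'"
      using ideal_pow_power[OF that, of p] ideal_pow_antimono[OF \<open>?m' \<le> ?m * p\<close>] by blast
    also have "\<dots> \<subseteq> frob_power ?J (p ^ e * p)"
      using least[of ?m' "Suc e"] by (simp add: mult.commute)
    also have "\<dots> \<subseteq> frob_power (frob_power ?J (p ^ e)) p"
      by (rule frob_power_mult_subset)
    finally have "f ^ p \<in> frob_power (frob_power ?J (p ^ e)) p" .
    \<comment> \<open>The root-taking lemma is applied with q = p, that is, with exponent 1.\<close>
    moreover have "p = CHAR('k) ^ 1"
      using assms(2) by simp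
    ultimately show ?thesis
      using mem_of_power_mem_frob_power[OF assms(1)] is_ideal_frob_power by blast
  qed
  then have "ideal_pow \<aa> ?m \<subseteq> frob_power ?J (p ^ e)"
    by blast
  moreover have "p ^ e = CHAR('k) ^ e"
    by (simp only: assms(2))
  ultimately show ?thesis
    using frob_root_is_least(3)[OF assms(1) _ is_ideal_ideal_pow] least by blast
qed

theorem proposition3p2:
  fixes p d :: nat
    and c :: real
    and \<aa> :: "('n::finite, 'k::field) mpoly set"
  assumes "CHAR('k) = p" and "p > 0"
    and "finite_degree_over {x ^ p |x :: 'k. True}"
    and "is_ideal \<aa>"
    and "\<exists>G. (\<forall>g\<in>G. total_degree g \<le> d) \<and> \<aa> = ideal_gen G"
    and "c \<ge> 0"
  shows "\<exists>G. (\<forall>g\<in>G. int (total_degree g) \<le> \<lfloor>c * real d\<rfloor>) \<and> test_ideal p \<aa> c = ideal_gen G"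
proof (cases "c = 0")
  case True
  show ?thesis
  proof (cases "\<aa> = {0}")
    case True
    then show ?thesis
      using \<open>c = 0\<close> by (intro exI[of _ "{}"])
        (simp add: test_ideal_def ideal_gen_def module.span_empty[OF module_mult])
  next
    case False
    then show ?thesis
      using \<open>c = 0\<close> by (intro exI[of _ "{1}"]) (simp add: test_ideal_def ideal_gen_1)
  qed
next
  case False
  have prime: "prime CHAR('k)"
    using assms(1,2) by (intro prime_CHAR_semidom) simp
  then have "p > 1"
    using assms(1) prime_gt_1_nat by blast
  obtain G where G: "\<forall>g\<in>G. total_degree g \<le> d" "\<aa> = ideal_gen G"
    using assms(5) by blast
  define m where "m e = nat \<lceil>c * real (p ^ e)\<rceil>" for e
  define S where "S e = frob_root (ideal_pow \<aa> (m e)) (p ^ e)" for e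
  have S_mono: "S i \<subseteq> S j" if "i \<le> j" for i j
  proof (rule lift_Suc_mono_le[OF _ that])
    show "S e \<subseteq> S (Suc e)" for e
      unfolding S_def m_def by (rule frob_root_ideal_pow_mono[OF prime assms(1,6)])
  qed
  \<comment> \<open>The generators are the operator values on generators of the
    \<open>m e\<close>-th power of \<open>\<aa>\<close>, which have degree at most
    \<open>d * m e\<close>.\<close>
  have gen: "\<exists>H. (\<forall>h\<in>H. p ^ e * total_degree h \<le> d * m e) \<and> S e = ideal_gen H" for e
  proof -
    obtain H where H: "\<forall>h\<in>H. total_degree h \<le> d * m e" "ideal_pow \<aa> (m e) = ideal_gen H"
      using ideal_pow_ideal_gen_degree_le[OF G(1)] G(2) by blast
    have "p ^ e * total_degree (cartier (p ^ e) \<phi> \<alpha> h) \<le> d * m e" if "h \<in> H" for \<phi> \<alpha> h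
      using total_degree_cartier[of "p ^ e" \<phi> \<alpha> h] H(1) that by fastforce
    moreover have "p ^ e = CHAR('k) ^ e"
      by (simp only: assms(1))
    then have "S e = ideal_gen
        {cartier (p ^ e) \<phi> \<alpha> h |\<phi> \<alpha> h. inv_frob_linear (p ^ e) \<phi> \<and> h \<in> H}"
      unfolding S_def H(2) by (rule frob_root_eq_cartier_ideal[OF prime])
    ultimately show ?thesis
      by (intro exI conjI) auto
  qed
  have S_ideal: "is_ideal (S e)" for e
    using gen[of e] is_ideal_ideal_gen by auto
  \<comment> \<open>The ceiling in \<open>m e\<close> raises the degree bound to at most
    \<open>c * d + d / p ^ e\<close>. The denominator is the positive gap from \<open>c * d\<close>
    to the next larger integer, and \<open>E\<close> makes \<open>d / p ^ e\<close> smaller than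
    this gap for all \<open>e \<ge> E\<close>.\<close>
  obtain E where E: "real d / (real_of_int \<lfloor>c * real d\<rfloor> + 1 - c * real d) < real p ^ E"
    using \<open>p > 1\<close> real_arch_pow[of "real p"] by auto
  have bound: "int t \<le> \<lfloor>c * real d\<rfloor>" if "E \<le> e" "p ^ e * t \<le> d * m e" for e t
  proof -
    define Q N where "Q = real (p ^ e)" and "N = real_of_int \<lfloor>c * real d\<rfloor> + 1"
    have "real p ^ E \<le> Q"
      unfolding Q_def using that(1) \<open>p > 1\<close> by simp
    then have "real d / (N - c * real d) < Q"
      unfolding N_def using E by linarith
    moreover have "0 < N - c * real d"
      unfolding N_def by linarith
    ultimately have d: "real d < Q * (N - c * real d)"
      by (simp only: divide_less_eq if_True)
    have "real (m e) \<le> c * Q + 1"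
      unfolding m_def Q_def using \<open>c \<ge> 0\<close> by (simp add: of_nat_nat ceiling_le_iff)
    have "Q * real t \<le> real d * real (m e)"
      unfolding Q_def using that(2) by (simp only: of_nat_le_iff flip: of_nat_mult)
    also have "\<dots> \<le> real d * (c * Q + 1)"
      using \<open>real (m e) \<le> c * Q + 1\<close> by (intro mult_left_mono) simp_all
    also have "\<dots> = Q * (c * real d) + real d"
      by (simp only: distrib_left mult_1_right mult.assoc mult.commute mult.left_commute)
    also have "\<dots> < Q * N"
      using d by (simp only: right_diff_distrib)
    finally have "real t < N"
      by (rule mult_less_cancel_left_pos[THEN iffD1, rotated]) (use \<open>p > 1\<close> in \<open>simp add: Q_def\<close>)
    then show ?thesis
      unfolding N_def by linarith
  qed
  let ?T = "test_ideal p \<aa> c"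
  have T: "?T = (\<Union>e\<in>{0<..}. S e)"
    using False by (simp add: test_ideal_def S_def m_def)
  have "is_ideal ?T"
    unfolding T
  proof (rule is_ideal_directed_UN)
    show "\<exists>k\<in>{0<..}. S i \<subseteq> S k \<and> S j \<subseteq> S k" if "i \<in> {0<..}" "j \<in> {0<..}" for i j
      using that S_mono[of i "max i j"] S_mono[of j "max i j"]
      by (intro bexI[of _ "max i j"]) auto
  qed (use S_ideal in auto)
  \<comment> \<open>Taking all elements of low degree avoids having to find a stage at which the
    chain becomes constant.\<close>
  define H where "H = {h \<in> ?T. int (total_degree h) \<le> \<lfloor>c * real d\<rfloor>}"
  have "S i \<subseteq> ideal_gen H" if "i > 0" for i
  proof -
    \<comment> \<open>This stage contains \<open>S i\<close>, is late enough for
      \<open>bound\<close>, and is positive, so \<open>S ?e\<close> is part of the union.\<close>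
    let ?e = "max i E"
    obtain K where K: "\<forall>h\<in>K. p ^ ?e * total_degree h \<le> d * m ?e" "S ?e = ideal_gen K"
      using gen by blast
    have "K \<subseteq> ?T"
      unfolding T using that K(2) ideal_gen_base by fastforce
    then have "K \<subseteq> H"
      using K(1) bound[of ?e] by (auto simp: H_def)
    have "S i \<subseteq> S ?e"
      by (rule S_mono) simp
    also have "\<dots> \<subseteq> ideal_gen H"
      unfolding K(2) by (rule ideal_gen_mono) fact
    finally show ?thesis .
  qed
  then have "?T \<subseteq> ideal_gen H"
    unfolding T by blast
  moreover have "ideal_gen H \<subseteq> ?T"
    using \<open>is_ideal ?T\<close> by (intro ideal_gen_minimal) (auto simp: H_def)
  ultimately show ?thesis
    by (intro exI[of _ H]) (auto simp: H_def)
qed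

end
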